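(* Let $N\ge2$, $\rho_L,\rho_R\in(0,1)$, and let $\mu_{\mathrm{stat}}$ be the stationary distribution of the boundary driven symmetric exclusion process on the homogeneous segment, i.e. with $\omega_{x,y}=\mathbf 1_{\{|x-y|=1\}}$ for all $x,y\in[N-1]$ and $\omega_L=\omega_R=1$. Then for all $n\in\mathbb N$ and all integers $1\le x_1<\dots<x_n\le N-1$, $$\mathbb E_{\mu_{\mathrm{stat}}}\Big[\prod_{i=1}^n\big(\eta(x_i)-\mathbb E_{\mu_{\mathrm{stat}}}[\eta(x_i)]\big)\Big]=(\rho_R-\rho_L)^n\,\psi(x_1,\dots,x_n),$$ where $$\psi(x_1,\dots,x_n)=\sum_{j=0}^n(-1)^{n-j}\sum_{1\le i_1<\dots<i_j\le n}\ \prod_{\ell=1}^j\frac{x_{i_\ell}-(\ell-1)}{N-(\ell-1)}\prod_{r\in\{1,\dots,n\}\setminus\{i_1,\dots,i_j\}}\frac{x_r}{N},$$ and $$\mathbb E_{\mu_{\mathrm{stat}}}\Big[\prod_{i=1}^n\eta(x_i)\Big]=\sum_{j=0}^n\rho_L^{n-j}(\rho_R-\rho_L)^j\sum_{1\le i_1<\dots<i_j\le n}\ \prod_{\ell=1}^j\frac{x_{i_\ell}-(\ell-1)}{N-(\ell-1)}.$$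
   Context: $[N-1]:=\{1,\dots,N-1\}$. The boundary driven symmetric exclusion process with conductances $\omega_{x,y}$ on the edges $\{x,y\}\in E$ of a connected graph on $[N-1]$ (here the edges are the pairs with $|x-y|=1$) and reservoir parameters $\rho_L,\rho_R\in(0,1)$, $\omega_L,\omega_R>0$ is the continuous-time Markov process $(\eta_t)_{t\ge0}$ on $\mathcal X=\{0,1\}^{[N-1]}$ with generator $\mathcal L=\mathcal L^{\mathrm{bulk}}+\omega_L\mathcal L_L+\omega_R\mathcal L_R$, where for $f:\mathcal X\to\mathbb R$ $$\mathcal L^{\mathrm{bulk}}f(\eta)=\sum_{\{x,y\}\in E}\omega_{x,y}\big\{\eta(x)(1-\eta(y))(f(\eta^{x,y})-f(\eta))+\eta(y)(1-\eta(x))(f(\eta^{y,x})-f(\eta))\big\},$$ $$\mathcal L_Lf(\eta)=\eta(1)(1-\rho_L)(f(\eta^{1,-})-f(\eta))+\rho_L(1-\eta(1))(f(\eta^{1,+})-f(\eta)),$$ $$\mathcal L_Rf(\eta)=\eta(N-1)(1-\rho_R)(f(\eta^{N-1,-})-f(\eta))+\rho_R(1-\eta(N-1))(f(\eta^{N-1,+})-f(\eta)).$$ Here $\eta^{x,y}$ is $\eta$ with a particle moved from $x$ to $y$; $\eta^{x,-}$ (resp. $\eta^{x,+}$) is $\eta$ with the particle at $x$ removed (resp. a particle created at $x$). $\mathbb E_{\mu_{\mathrm{stat}}}$ denotes expectation over $\eta\in\mathcal X$ distributed according to the unique stationary distribution $\mu_{\mathrm{stat}}$. Empty products equal $1$,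 and for $j=0$ the sum over $i_1<\dots<i_j$ has one (empty) term. *)

theory Defs
  imports "HOL-Probability.Probability"
begin

type_synonym config = "nat \<Rightarrow> nat"

definition sites :: "nat \<Rightarrow> nat set" where
  "sites N = {1..N - 1}"

definition configs :: "nat \<Rightarrow> config set" where
  "configs N = sites N \<rightarrow>\<^sub>E {0, 1}"

(* Each unordered edge {x, y} with |x - y| = 1 is listed once, as the pair with x < y. *)
definition edges :: "nat \<Rightarrow> (nat \<times> nat) set" where
  "edges N = {(x, y). x \<in> sites N \<and> y \<in> sites N \<and> x < y \<and> \<bar>int x - int y\<bar> = 1}"

(* In the generator these maps only matter where the corresponding rate is nonzero,
   that is, where the move, removal or creation of a particle is possible. *)
definition move :: "config \<Rightarrow> nat \<Rightarrow> nat \<Rightarrow> config" where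
  "move \<eta> x y = \<eta>(x := 0, y := 1)"

definition remove :: "config \<Rightarrow> nat \<Rightarrow> config" where
  "remove \<eta> x = \<eta>(x := 0)"

definition create :: "config \<Rightarrow> nat \<Rightarrow> config" where
  "create \<eta> x = \<eta>(x := 1)"

definition bulk_gen ::
  "nat \<Rightarrow> (nat \<Rightarrow> nat \<Rightarrow> real) \<Rightarrow> (config \<Rightarrow> real) \<Rightarrow> config \<Rightarrow> real" where
  "bulk_gen N \<omega> f \<eta> = (\<Sum>(x, y)\<in>edges N. \<omega> x y *
      (real (\<eta> x) * (1 - real (\<eta> y)) * (f (move \<eta> x y) - f \<eta>)
     + real (\<eta> y) * (1 - real (\<eta> x)) * (f (move \<eta> y x) - f \<eta>)))"

definition reservoir_gen :: "nat \<Rightarrow> real \<Rightarrow> (config \<Rightarrow> real) \<Rightarrow> config \<Rightarrow> real" where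
  "reservoir_gen x \<rho> f \<eta> =
      real (\<eta> x) * (1 - \<rho>) * (f (remove \<eta> x) - f \<eta>)
    + \<rho> * (1 - real (\<eta> x)) * (f (create \<eta> x) - f \<eta>)"

definition generator ::
  "nat \<Rightarrow> (nat \<Rightarrow> nat \<Rightarrow> real) \<Rightarrow> real \<Rightarrow> real \<Rightarrow> real \<Rightarrow> real
    \<Rightarrow> (config \<Rightarrow> real) \<Rightarrow> config \<Rightarrow> real" where
  "generator N \<omega> \<omega>L \<omega>R \<rho>L \<rho>R f \<eta> =
      bulk_gen N \<omega> f \<eta> + \<omega>L * reservoir_gen 1 \<rho>L f \<eta> + \<omega>R * reservoir_gen (N - 1) \<rho>R f \<eta>"

(* The transition semigroup (P_t f)(\<eta>) = E[f(\<eta>_t) | \<eta>_0 = \<eta>] of the process, which is the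
   operator exponential exp(t L) because the state space is finite. *)
definition semigroup ::
  "nat \<Rightarrow> (nat \<Rightarrow> nat \<Rightarrow> real) \<Rightarrow> real \<Rightarrow> real \<Rightarrow> real \<Rightarrow> real
    \<Rightarrow> real \<Rightarrow> (config \<Rightarrow> real) \<Rightarrow> config \<Rightarrow> real" where
  "semigroup N \<omega> \<omega>L \<omega>R \<rho>L \<rho>R t f \<eta> =
      (\<Sum>k. t ^ k / fact k * ((generator N \<omega> \<omega>L \<omega>R \<rho>L \<rho>R ^^ k) f) \<eta>)"

definition stationary_distribution ::
  "nat \<Rightarrow> (nat \<Rightarrow> nat \<Rightarrow> real) \<Rightarrow> real \<Rightarrow> real \<Rightarrow> real \<Rightarrow> real \<Rightarrow> config pmf \<Rightarrow> bool" where
  "stationary_distribution N \<omega> \<omega>L \<omega>R \<rho>L \<rho>R \<mu> \<longleftrightarrow>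
      set_pmf \<mu> \<subseteq> configs N \<and>
      (\<forall>t\<ge>0. \<forall>f. measure_pmf.expectation \<mu> (semigroup N \<omega> \<omega>L \<omega>R \<rho>L \<rho>R t f)
                = measure_pmf.expectation \<mu> f)"

(* Index tuples 1 \<le> i_1 < ... < i_j \<le> n; for j = 0 there is exactly one, the empty tuple. *)
definition index_tuples :: "nat \<Rightarrow> nat \<Rightarrow> (nat \<Rightarrow> nat) set" where
  "index_tuples j n = {i \<in> {1..j} \<rightarrow>\<^sub>E {1..n}. strict_mono_on {1..j} i}"

definition shifted_prod :: "nat \<Rightarrow> (nat \<Rightarrow> nat) \<Rightarrow> nat \<Rightarrow> (nat \<Rightarrow> nat) \<Rightarrow> real" where
  "shifted_prod N x j i =
      (\<Prod>l = 1..j. (real (x (i l)) - (real l - 1)) / (real N - (real l - 1)))"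

definition psi :: "nat \<Rightarrow> nat \<Rightarrow> (nat \<Rightarrow> nat) \<Rightarrow> real" where
  "psi N n x = (\<Sum>j = 0..n. (-1) ^ (n - j) * (\<Sum>i\<in>index_tuples j n.
      shifted_prod N x j i * (\<Prod>r\<in>{1..n} - i ` {1..j}. real (x r) / real N)))"

end

theory Submission imports Defs begin

text \<open>
  Both formulas follow from the moments of the products \<open>\<Prod>a\<in>A. (\<eta> a - \<rho>L)\<close> over sets of sites \<open>A\<close>:
  in the stationary state these equal \<open>(\<rho>R - \<rho>L) ^ card A * unit_corr N A\<close>, where \<open>unit_corr N A\<close>
  is the product of \<open>(a\<^sub>l - (l - 1)) / (N - (l - 1))\<close> over the increasing enumeration
  \<open>a\<^sub>1 < a\<^sub>2 < \<dots>\<close> of \<open>A\<close> (lemma \<open>expectation_centered_prod\<close>). Writing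
  \<open>\<eta> a = (\<eta> a - \<rho>L) + \<rho>L\<close>, respectively \<open>\<eta> a - E[\<eta> a] = (\<eta> a - \<rho>L) - (\<rho>R - \<rho>L) * a / N\<close>, and
  multiplying out turns this into the two sums over sub-tuples in the theorem.

  The moments are found by duality. Stationarity gives that the generator has mean zero
  (\<open>stationary_expectation_generator\<close>). On products centered at \<open>\<rho>L\<close> the generator is closed: a bulk
  edge acts by swapping its endpoints in the set \<open>A\<close>, the left reservoir kills \<open>A\<close> at rate one when
  \<open>1 \<in> A\<close>, and the right reservoir replaces \<open>A\<close> by \<open>(\<rho>R - \<rho>L)\<close> times \<open>A - {N - 1}\<close> when
  \<open>N - 1 \<in> A\<close>. So the moments solve a linear balance system on sets of sites, which couples a set
  only to sets of the same size and to one set with one element fewer.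

  Two facts finish the argument. The value at the empty set determines the solution, because a
  difference of two solutions that agree on the smaller sets satisfies a maximum principle
  (\<open>balance_max_principle\<close>). And \<open>unit_corr\<close> solves the system with \<open>\<rho>R - \<rho>L\<close> scaled to one
  (\<open>unit_corr_balance\<close>): swapping \<open>z\<close> and \<open>z + 1\<close> changes the numerator of \<open>unit_corr\<close> by a difference
  \<open>q z - q (z + 1)\<close>, so the sum over all edges telescopes and only the two reservoir terms survive.
\<close>

section \<open>Configurations and bounds on the generator\<close>

lemma finite_configs: "finite (configs N)"
  unfolding configs_def sites_def by (intro finite_PiE) auto

lemma configs_values:
  assumes "\<eta> \<in> configs N" "x \<in> sites N"
  shows "\<eta> x = 0 \<or> \<eta> x = 1"
  using assms unfolding configs_def by (auto simp: PiE_iff)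

lemma configs_upd:
  assumes "\<eta> \<in> configs N" "x \<in> sites N" "v \<in> {0, 1}"
  shows "\<eta>(x := v) \<in> configs N"
  using assms unfolding configs_def by (auto simp: PiE_iff extensional_def)

lemma edges_eq: "edges N = (\<lambda>z. (z, Suc z)) ` {1..<N - 1}"
  unfolding edges_def sites_def by (auto simp: image_iff)

lemma reservoir_gen_bound:
  assumes \<eta>: "\<eta> \<in> configs N" and x: "x \<in> sites N"
    and bound: "\<And>\<zeta>. \<zeta> \<in> configs N \<Longrightarrow> \<bar>f \<zeta>\<bar> \<le> B"
  shows "\<bar>reservoir_gen x \<rho> f \<eta>\<bar> \<le> 2 * (\<bar>1 - \<rho>\<bar> + \<bar>\<rho>\<bar>) * B"
proof -
  have d: "\<bar>f \<zeta> - f \<eta>\<bar> \<le> 2 * B" if "\<zeta> \<in> configs N" for \<zeta>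
    using bound[OF that] bound[OF \<eta>] by linarith
  have B: "0 \<le> B" using bound[OF \<eta>] by linarith
  have r: "\<bar>f (remove \<eta> x) - f \<eta>\<bar> \<le> 2 * B" "\<bar>f (create \<eta> x) - f \<eta>\<bar> \<le> 2 * B"
    using \<eta> x by (auto intro!: d configs_upd simp: remove_def create_def)
  from configs_values[OF \<eta> x] show ?thesis
  proof
    assume "\<eta> x = 0"
    then have "\<bar>reservoir_gen x \<rho> f \<eta>\<bar> = \<bar>\<rho>\<bar> * \<bar>f (create \<eta> x) - f \<eta>\<bar>"
      by (simp add: reservoir_gen_def abs_mult)
    also have "\<dots> \<le> \<bar>\<rho>\<bar> * (2 * B)" using r by (intro mult_left_mono) auto
    also have "\<dots> \<le> 2 * (\<bar>1 - \<rho>\<bar> + \<bar>\<rho>\<bar>) * B" using B by (simp add: algebra_simps)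
    finally show ?thesis .
  next
    assume "\<eta> x = 1"
    then have "\<bar>reservoir_gen x \<rho> f \<eta>\<bar> = \<bar>1 - \<rho>\<bar> * \<bar>f (remove \<eta> x) - f \<eta>\<bar>"
      by (simp add: reservoir_gen_def abs_mult)
    also have "\<dots> \<le> \<bar>1 - \<rho>\<bar> * (2 * B)" using r by (intro mult_left_mono) auto
    also have "\<dots> \<le> 2 * (\<bar>1 - \<rho>\<bar> + \<bar>\<rho>\<bar>) * B" using B by (simp add: algebra_simps)
    finally show ?thesis .
  qed
qed

lemma bulk_gen_bound:
  assumes \<eta>: "\<eta> \<in> configs N"
    and bound: "\<And>\<zeta>. \<zeta> \<in> configs N \<Longrightarrow> \<bar>f \<zeta>\<bar> \<le> B"
  shows "\<bar>bulk_gen N \<omega> f \<eta>\<bar> \<le> 2 * (\<Sum>(x, y)\<in>edges N. \<bar>\<omega> x y\<bar>) * B"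
proof -
  have d: "\<bar>f \<zeta> - f \<eta>\<bar> \<le> 2 * B" if "\<zeta> \<in> configs N" for \<zeta>
    using bound[OF that] bound[OF \<eta>] by linarith
  have B: "0 \<le> B" using bound[OF \<eta>] by linarith
  have "\<bar>bulk_gen N \<omega> f \<eta>\<bar> \<le> (\<Sum>(x, y)\<in>edges N. \<bar>\<omega> x y\<bar> * (2 * B))"
    unfolding bulk_gen_def
  proof (rule sum_abs[THEN order_trans], rule sum_mono, clarify)
    fix x y assume "(x, y) \<in> edges N"
    then have xy: "x \<in> sites N" "y \<in> sites N" by (auto simp: edges_def)
    have m: "\<bar>f (move \<eta> x y) - f \<eta>\<bar> \<le> 2 * B" "\<bar>f (move \<eta> y x) - f \<eta>\<bar> \<le> 2 * B"
      using \<eta> xy by (auto intro!: d configs_upd simp: move_def)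
    have "\<bar>real (\<eta> x) * (1 - real (\<eta> y)) * (f (move \<eta> x y) - f \<eta>)
        + real (\<eta> y) * (1 - real (\<eta> x)) * (f (move \<eta> y x) - f \<eta>)\<bar> \<le> 2 * B"
      using configs_values[OF \<eta> xy(1)] configs_values[OF \<eta> xy(2)] m B by auto
    then show "\<bar>\<omega> x y * (real (\<eta> x) * (1 - real (\<eta> y)) * (f (move \<eta> x y) - f \<eta>)
        + real (\<eta> y) * (1 - real (\<eta> x)) * (f (move \<eta> y x) - f \<eta>))\<bar> \<le> \<bar>\<omega> x y\<bar> * (2 * B)"
      by (simp only: abs_mult) (intro mult_left_mono, auto)
  qed
  also have "\<dots> = 2 * (\<Sum>(x, y)\<in>edges N. \<bar>\<omega> x y\<bar>) * B"
    by (simp add: sum_distrib_left sum_distrib_right split_def mult_ac)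
  finally show ?thesis .
qed

text \<open>The supremum norm over configurations is multiplied by at most a constant, so the powers of the
  generator grow at most geometrically and the exponential series converges.\<close>
lemma generator_bounded:
  assumes "N \<ge> 2"
  obtains C where "0 \<le> C"
    "\<And>f B \<eta>. (\<And>\<zeta>. \<zeta> \<in> configs N \<Longrightarrow> \<bar>f \<zeta>\<bar> \<le> B) \<Longrightarrow> \<eta> \<in> configs N \<Longrightarrow>
       \<bar>generator N \<omega> \<omega>L \<omega>R \<rho>L \<rho>R f \<eta>\<bar> \<le> C * B"
proof
  define CB where "CB = 2 * (\<Sum>(x, y)\<in>edges N. \<bar>\<omega> x y\<bar>)"
  define CL where "CL = 2 * (\<bar>1 - \<rho>L\<bar> + \<bar>\<rho>L\<bar>)"
  define CR where "CR = 2 * (\<bar>1 - \<rho>R\<bar> + \<bar>\<rho>R\<bar>)"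
  show "0 \<le> CB + \<bar>\<omega>L\<bar> * CL + \<bar>\<omega>R\<bar> * CR"
    unfolding CB_def CL_def CR_def by (auto intro!: add_nonneg_nonneg sum_nonneg)
  fix f :: "config \<Rightarrow> real" and B \<eta>
  assume f: "\<And>\<zeta>. \<zeta> \<in> configs N \<Longrightarrow> \<bar>f \<zeta>\<bar> \<le> B" and \<eta>: "\<eta> \<in> configs N"
  have s: "1 \<in> sites N" "N - 1 \<in> sites N" using assms by (auto simp: sites_def)
  have "\<bar>bulk_gen N \<omega> f \<eta>\<bar> \<le> CB * B"
    unfolding CB_def by (rule bulk_gen_bound[OF \<eta> f])
  moreover have "\<bar>\<omega>L * reservoir_gen 1 \<rho>L f \<eta>\<bar> \<le> \<bar>\<omega>L\<bar> * (CL * B)"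
    unfolding CL_def abs_mult by (intro mult_left_mono reservoir_gen_bound[OF \<eta> s(1) f]) auto
  moreover have "\<bar>\<omega>R * reservoir_gen (N - 1) \<rho>R f \<eta>\<bar> \<le> \<bar>\<omega>R\<bar> * (CR * B)"
    unfolding CR_def abs_mult by (intro mult_left_mono reservoir_gen_bound[OF \<eta> s(2) f]) auto
  ultimately show "\<bar>generator N \<omega> \<omega>L \<omega>R \<rho>L \<rho>R f \<eta>\<bar> \<le> (CB + \<bar>\<omega>L\<bar> * CL + \<bar>\<omega>R\<bar> * CR) * B"
    unfolding generator_def distrib_right mult.assoc by linarith
qed

section \<open>Stationarity annihilates the generator\<close>

lemma expectation_eq_sum:
  fixes f :: "config \<Rightarrow> real"
  assumes "set_pmf \<mu> \<subseteq> configs N"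
  shows "measure_pmf.expectation \<mu> f = (\<Sum>\<eta>\<in>configs N. f \<eta> * pmf \<mu> \<eta>)"
  using assms by (intro integral_measure_pmf_real finite_configs) auto

text \<open>The first coefficient is the derivative at zero, which the right difference quotients determine;
  constancy on the half-line is all that a semigroup indexed by \<open>t \<ge> 0\<close> provides.\<close>
lemma powser_coeff_zero_of_const_right:
  fixes a :: "nat \<Rightarrow> real"
  assumes summable: "\<And>t. summable (\<lambda>k. a k * t ^ k)"
    and const: "\<And>t. t \<ge> 0 \<Longrightarrow> (\<Sum>k. a k * t ^ k) = c"
  shows "a 1 = 0"
proof -
  define g where "g t = (\<Sum>k. a k * t ^ k)" for t
  have "DERIV g 0 :> (\<Sum>k. diffs a k * 0 ^ k)"
    unfolding g_def by (rule termdiffs_strong[of a 1]) (use summable[of 1] in auto)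
  then have "DERIV g 0 :> a 1"
    by (simp add: powser_zero diffs_def)
  then have "((\<lambda>h. (g (0 + h) - g 0) / h) \<longlongrightarrow> a 1) (at_right 0)"
    unfolding DERIV_def by (rule tendsto_within_subset) auto
  moreover have "g h = g 0" if "h > 0" for h
    using const[of h] const[of 0] that unfolding g_def by simp
  then have "((\<lambda>h. (g (0 + h) - g 0) / h) \<longlongrightarrow> 0) (at_right 0)"
    by (intro tendsto_eventually eventually_at_right_less[THEN eventually_mono]) simp
  ultimately show ?thesis
    using tendsto_unique trivial_limit_at_right_real by blast
qed

text \<open>The mean of \<open>f\<close> under the semigroup is a power series in \<open>t\<close> whose linear coefficient is the
  mean of the generator; stationarity makes the series constant on \<open>t \<ge> 0\<close>.\<close>
lemma stationary_expectation_generator: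
  assumes N: "N \<ge> 2"
    and stat: "stationary_distribution N \<omega> \<omega>L \<omega>R \<rho>L \<rho>R \<mu>"
  shows "measure_pmf.expectation \<mu> (generator N \<omega> \<omega>L \<omega>R \<rho>L \<rho>R f) = 0"
proof -
  define G where "G = generator N \<omega> \<omega>L \<omega>R \<rho>L \<rho>R"
  have supp: "set_pmf \<mu> \<subseteq> configs N"
    using stat by (simp add: stationary_distribution_def)
  obtain C where "0 \<le> C" and C: "\<And>f B \<eta>. (\<And>\<zeta>. \<zeta> \<in> configs N \<Longrightarrow> \<bar>f \<zeta>\<bar> \<le> B) \<Longrightarrow>
      \<eta> \<in> configs N \<Longrightarrow> \<bar>G f \<eta>\<bar> \<le> C * B"
    unfolding G_def using generator_bounded[OF N] by blast
  define B where "B = (\<Sum>\<zeta>\<in>configs N. \<bar>f \<zeta>\<bar>)"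
  have iter: "\<bar>(G ^^ k) f \<eta>\<bar> \<le> C ^ k * B" if "\<eta> \<in> configs N" for k \<eta>
    using that
  proof (induction k arbitrary: \<eta>)
    case 0
    then show ?case unfolding B_def
      using member_le_sum[of \<eta> "configs N" "\<lambda>\<zeta>. \<bar>f \<zeta>\<bar>"] finite_configs by simp
  next
    case (Suc k)
    then show ?case using C[of "(G ^^ k) f" "C ^ k * B" \<eta>] by (simp add: mult_ac)
  qed
  have summable_at: "summable (\<lambda>k. t ^ k / fact k * (G ^^ k) f \<eta>)" if "\<eta> \<in> configs N" for t \<eta>
  proof (rule summable_comparison_test')
    show "summable (\<lambda>k. B * ((\<bar>t\<bar> * C) ^ k /\<^sub>R fact k))"
      by (intro summable_mult summable_exp_generic)
    fix k :: nat
    have "norm (t ^ k / fact k * (G ^^ k) f \<eta>) = \<bar>t\<bar> ^ k / fact k * \<bar>(G ^^ k) f \<eta>\<bar>"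
      by (simp add: abs_mult power_abs)
    also have "\<dots> \<le> \<bar>t\<bar> ^ k / fact k * (C ^ k * B)"
      using iter[OF that] by (intro mult_left_mono) auto
    finally show "norm (t ^ k / fact k * (G ^^ k) f \<eta>) \<le> B * ((\<bar>t\<bar> * C) ^ k /\<^sub>R fact k)"
      by (simp add: power_mult_distrib field_simps)
  qed
  define a where "a k = (\<Sum>\<eta>\<in>configs N. (G ^^ k) f \<eta> * pmf \<mu> \<eta>) / fact k" for k
  have a_eq: "a k * t ^ k = (\<Sum>\<eta>\<in>configs N. t ^ k / fact k * (G ^^ k) f \<eta> * pmf \<mu> \<eta>)" for k t
    by (simp add: a_def sum_distrib_left sum_distrib_right sum_divide_distrib mult_ac)
  have sum_a: "summable (\<lambda>k. a k * t ^ k)" for t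
    unfolding a_eq by (intro summable_sum summable_mult2 summable_at)
  have "(\<Sum>k. a k * t ^ k) = measure_pmf.expectation \<mu> f" if "t \<ge> 0" for t
  proof -
    have "(\<Sum>k. a k * t ^ k)
        = (\<Sum>\<eta>\<in>configs N. \<Sum>k. t ^ k / fact k * (G ^^ k) f \<eta> * pmf \<mu> \<eta>)"
      unfolding a_eq by (intro suminf_sum summable_mult2 summable_at)
    also have "\<dots> = (\<Sum>\<eta>\<in>configs N. semigroup N \<omega> \<omega>L \<omega>R \<rho>L \<rho>R t f \<eta> * pmf \<mu> \<eta>)"
      unfolding semigroup_def G_def[symmetric]
      by (intro sum.cong refl suminf_mult2[symmetric] summable_at)
    also have "\<dots> = measure_pmf.expectation \<mu> f"
      using stat that expectation_eq_sum[OF supp]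
      by (simp add: stationary_distribution_def)
    finally show ?thesis .
  qed
  from powser_coeff_zero_of_const_right[OF sum_a this] show ?thesis
    by (simp add: a_def expectation_eq_sum[OF supp] G_def)
qed

section \<open>Duality with sets of sites\<close>

abbreviation adj_swap :: "nat \<Rightarrow> nat \<Rightarrow> nat" where
  "adj_swap z \<equiv> Transposition.transpose z (Suc z)"

definition centered_prod :: "real \<Rightarrow> nat set \<Rightarrow> config \<Rightarrow> real" where
  "centered_prod \<rho> A \<eta> = (\<Prod>a\<in>A. real (\<eta> a) - \<rho>)"

lemma finite_sites: "finite (sites N)"
  by (simp add: sites_def)

lemma card_swap: "card (adj_swap z ` A) = card A"
  by (simp add: card_image)

lemma swap_subset_sites:
  assumes "A \<subseteq> sites N" "z \<in> {1..<N - 1}"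
  shows "adj_swap z ` A \<subseteq> sites N"
  using assms by (auto simp: sites_def Transposition.transpose_def)

lemma swap_both: "z \<in> A \<Longrightarrow> Suc z \<in> A \<Longrightarrow> adj_swap z ` A = A"
  by (rule transpose_image_eq) simp

lemma swap_neither: "z \<notin> A \<Longrightarrow> Suc z \<notin> A \<Longrightarrow> adj_swap z ` A = A"
  by (rule transpose_image_eq) simp

lemma swap_left: "z \<in> A \<Longrightarrow> Suc z \<notin> A \<Longrightarrow> adj_swap z ` A = insert (Suc z) (A - {z})"
  by (auto simp: Transposition.transpose_def image_iff)

lemma swap_right: "z \<notin> A \<Longrightarrow> Suc z \<in> A \<Longrightarrow> adj_swap z ` A = insert z (A - {Suc z})"
  by (auto simp: Transposition.transpose_def image_iff)

text \<open>An edge whose endpoints agree contributes nothing, and one whose endpoints differ moves its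
  particle at rate one. Either way the effect is that of swapping the two occupation numbers,
  whatever the occupation: this stirring form is what makes the dual act on sets.\<close>
lemma bulk_gen_homogeneous:
  assumes \<eta>: "\<eta> \<in> configs N"
  shows "bulk_gen N (\<lambda>x y. of_bool (\<bar>int x - int y\<bar> = 1)) f \<eta>
       = (\<Sum>z\<in>{1..<N - 1}. f (\<eta> \<circ> adj_swap z) - f \<eta>)"
proof -
  have "inj_on (\<lambda>z. (z, Suc z)) {1..<N - 1}" by (auto simp: inj_on_def)
  then have "bulk_gen N (\<lambda>x y. of_bool (\<bar>int x - int y\<bar> = 1)) f \<eta>
    = (\<Sum>z\<in>{1..<N - 1}.
          real (\<eta> z) * (1 - real (\<eta> (Suc z))) * (f (move \<eta> z (Suc z)) - f \<eta>)
        + real (\<eta> (Suc z)) * (1 - real (\<eta> z)) * (f (move \<eta> (Suc z) z) - f \<eta>))"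
    by (simp add: bulk_gen_def edges_eq sum.reindex)
  also have "\<dots> = (\<Sum>z\<in>{1..<N - 1}. f (\<eta> \<circ> adj_swap z) - f \<eta>)"
  proof (rule sum.cong[OF refl])
    fix z assume "z \<in> {1..<N - 1}"
    then have z: "z \<in> sites N" "Suc z \<in> sites N" by (auto simp: sites_def)
    have eq: "\<eta> \<circ> adj_swap z = \<eta>" if "\<eta> z = \<eta> (Suc z)"
      using that by (auto simp: fun_eq_iff Transposition.transpose_def)
    have right: "\<eta> \<circ> adj_swap z = move \<eta> z (Suc z)" if "\<eta> z = 1" "\<eta> (Suc z) = 0"
      using that by (auto simp: fun_eq_iff Transposition.transpose_def move_def)
    have left: "\<eta> \<circ> adj_swap z = move \<eta> (Suc z) z" if "\<eta> z = 0" "\<eta> (Suc z) = 1"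
      using that by (auto simp: fun_eq_iff Transposition.transpose_def move_def)
    show "real (\<eta> z) * (1 - real (\<eta> (Suc z))) * (f (move \<eta> z (Suc z)) - f \<eta>)
        + real (\<eta> (Suc z)) * (1 - real (\<eta> z)) * (f (move \<eta> (Suc z) z) - f \<eta>)
        = f (\<eta> \<circ> adj_swap z) - f \<eta>"
      using configs_values[OF \<eta> z(1)] configs_values[OF \<eta> z(2)] eq left right by auto
  qed
  finally show ?thesis .
qed

lemma centered_prod_swap:
  "centered_prod \<rho> A (\<eta> \<circ> adj_swap z) = centered_prod \<rho> (adj_swap z ` A) \<eta>"
  unfolding centered_prod_def by (subst prod.reindex) auto

text \<open>Since \<open>centered_prod \<rho> A\<close> is affine in \<open>\<eta> x\<close>, the reservoir merely replaces the factor
  \<open>\<eta> x - \<rho>\<close>, if present, by its drift \<open>\<sigma> - \<eta> x\<close>. The term with the smaller set disappears for \<open>\<sigma> = \<rho>\<close>, which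
  is the reason for centering at the density of the left reservoir.\<close>
lemma reservoir_gen_centered_prod:
  assumes "finite A" "\<eta> x = 0 \<or> \<eta> x = 1"
  shows "reservoir_gen x \<sigma> (centered_prod \<rho> A) \<eta>
       = of_bool (x \<in> A) * ((\<sigma> - \<rho>) * centered_prod \<rho> (A - {x}) \<eta> - centered_prod \<rho> A \<eta>)"
proof (cases "x \<in> A")
  case True
  have rest: "centered_prod \<rho> (A - {x}) (\<eta>(x := v)) = centered_prod \<rho> (A - {x}) \<eta>" for v
    unfolding centered_prod_def by (intro prod.cong) auto
  have split: "centered_prod \<rho> A \<zeta> = (real (\<zeta> x) - \<rho>) * centered_prod \<rho> (A - {x}) \<zeta>" for \<zeta>
    unfolding centered_prod_def by (rule prod.remove[OF assms(1) True])
  show ?thesis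
    using assms(2) True
    by (auto simp: reservoir_gen_def remove_def create_def split rest algebra_simps)
next
  case False
  have "centered_prod \<rho> A (\<eta>(x := v)) = centered_prod \<rho> A \<eta>" for v
    unfolding centered_prod_def using False by (intro prod.cong) auto
  then show ?thesis using False by (simp add: reservoir_gen_def remove_def create_def)
qed

lemma expectation_centered_prod_balance:
  assumes N: "N \<ge> 2"
    and stat: "stationary_distribution N (\<lambda>x y. of_bool (\<bar>int x - int y\<bar> = 1)) 1 1 \<rho>L \<rho>R \<mu>"
    and A: "A \<subseteq> sites N"
  defines "m \<equiv> \<lambda>B. measure_pmf.expectation \<mu> (centered_prod \<rho>L B)"
  shows "(\<Sum>z\<in>{1..<N - 1}. m (adj_swap z ` A) - m A)
       = of_bool (1 \<in> A) * m A
       + of_bool (N - 1 \<in> A) * (m A - (\<rho>R - \<rho>L) * m (A - {N - 1}))"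
proof -
  let ?\<omega> = "\<lambda>x y. of_bool (\<bar>int x - int y\<bar> = 1) :: real" and ?g = "centered_prod \<rho>L"
  have supp: "set_pmf \<mu> \<subseteq> configs N"
    using stat by (simp add: stationary_distribution_def)
  have int [simp]: "integrable (measure_pmf \<mu>) f" for f :: "config \<Rightarrow> real"
    using finite_subset[OF supp finite_configs] by (rule integrable_measure_pmf_finite)
  have fin: "finite A" using A finite_sites finite_subset by blast
  have gen: "generator N ?\<omega> 1 1 \<rho>L \<rho>R (?g A) \<eta>
      = (\<Sum>z\<in>{1..<N - 1}. ?g (adj_swap z ` A) \<eta> - ?g A \<eta>)
      - of_bool (1 \<in> A) * ?g A \<eta>
      + of_bool (N - 1 \<in> A) * ((\<rho>R - \<rho>L) * ?g (A - {N - 1}) \<eta> - ?g A \<eta>)"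
    if \<eta>: "\<eta> \<in> configs N" for \<eta>
  proof -
    have ends: "1 \<in> sites N" "N - 1 \<in> sites N" using N by (auto simp: sites_def)
    have res: "reservoir_gen x \<sigma> (?g A) \<eta>
        = of_bool (x \<in> A) * ((\<sigma> - \<rho>L) * ?g (A - {x}) \<eta> - ?g A \<eta>)" if "x \<in> sites N" for x \<sigma>
      using fin configs_values[OF \<eta> that] by (rule reservoir_gen_centered_prod)
    show ?thesis
      by (simp only: generator_def bulk_gen_homogeneous[OF \<eta>] ends[THEN res] centered_prod_swap) simp
  qed
  have "0 = measure_pmf.expectation \<mu> (generator N ?\<omega> 1 1 \<rho>L \<rho>R (?g A))"
    using stationary_expectation_generator[OF N stat] by simp
  also have "\<dots> = measure_pmf.expectation \<mu> (\<lambda>\<eta>.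
      (\<Sum>z\<in>{1..<N - 1}. ?g (adj_swap z ` A) \<eta> - ?g A \<eta>)
      - of_bool (1 \<in> A) * ?g A \<eta>
      + of_bool (N - 1 \<in> A) * ((\<rho>R - \<rho>L) * ?g (A - {N - 1}) \<eta> - ?g A \<eta>))"
    using supp gen by (intro integral_cong_AE) (auto simp: AE_measure_pmf_iff)
  also have "\<dots> = (\<Sum>z\<in>{1..<N - 1}. m (adj_swap z ` A) - m A) - of_bool (1 \<in> A) * m A
      + of_bool (N - 1 \<in> A) * ((\<rho>R - \<rho>L) * m (A - {N - 1}) - m A)"
    unfolding m_def by simp
  finally show ?thesis by (simp add: algebra_simps)
qed

section \<open>Uniqueness for the balance equation\<close>

text \<open>At a maximiser \<open>B\<close> with positive maximum the left-hand side is at most zero and the right-hand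
  side at least zero, so both vanish: \<open>B\<close> avoids site 1, and every neighbour of \<open>B\<close> is again a maximiser.
  Moving the smallest element of \<open>B\<close> one step to the left then contradicts the choice of \<open>B\<close> as the
  maximiser with the least sum of elements.\<close>
lemma balance_max_principle:
  fixes d :: "nat set \<Rightarrow> real"
  assumes k: "k \<ge> 1"
    and balance: "\<And>A. A \<subseteq> sites N \<Longrightarrow> card A = k \<Longrightarrow>
      (\<Sum>z\<in>{1..<N - 1}. d (adj_swap z ` A) - d A)
        = of_bool (1 \<in> A) * d A + of_bool (N - 1 \<in> A) * d A"
    and A: "A \<subseteq> sites N" "card A = k"
  shows "d A \<le> 0"
proof (rule ccontr)
  assume pos: "\<not> d A \<le> 0"
  define S where "S = {B. B \<subseteq> sites N \<and> card B = k}"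
  have S: "finite S" "A \<in> S"
    unfolding S_def using finite_sites A by auto
  define M where "M = Max (d ` S)"
  have le_M: "d B \<le> M" if "B \<in> S" for B
    unfolding M_def using S that by simp
  have M: "M > 0" using le_M[OF S(2)] pos by simp
  have "M \<in> d ` S" unfolding M_def using S by (intro Max_in) auto
  then have "{B \<in> S. d B = M} \<noteq> {}" by auto
  then obtain B where "is_arg_min (\<lambda>B. \<Sum>B) (\<lambda>B. B \<in> {B \<in> S. d B = M}) B"
    using ex_is_arg_min_if_finite[of "{B \<in> S. d B = M}" "\<lambda>B. \<Sum>B"] S(1) by auto
  then have B: "B \<in> S" "d B = M"
    and least: "\<And>B'. B' \<in> S \<Longrightarrow> d B' = M \<Longrightarrow> \<Sum>B \<le> \<Sum>B'"
    by (auto simp: is_arg_min_linorder)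
  have Bs: "B \<subseteq> sites N" "card B = k" using B by (auto simp: S_def)
  have fin: "finite B" using Bs finite_sites finite_subset by blast
  have swap_S: "adj_swap z ` B \<in> S" if "z \<in> {1..<N - 1}" for z
    using swap_subset_sites[OF Bs(1) that] Bs(2) by (simp add: S_def card_swap)
  have nonneg: "0 \<le> M - d (adj_swap z ` B)" if "z \<in> {1..<N - 1}" for z
    using le_M[OF swap_S[OF that]] by simp
  have flow: "(\<Sum>z\<in>{1..<N - 1}. M - d (adj_swap z ` B))
      = - (of_bool (1 \<in> B) * M + of_bool (N - 1 \<in> B) * M)"
    using balance[OF Bs] B(2) by (simp add: sum_subtractf)
  moreover have "0 \<le> (\<Sum>z\<in>{1..<N - 1}. M - d (adj_swap z ` B))"
    using nonneg by (rule sum_nonneg)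
  ultimately have no1: "1 \<notin> B" and "(\<Sum>z\<in>{1..<N - 1}. M - d (adj_swap z ` B)) = 0"
    using M by (auto simp: of_bool_def split: if_splits)
  then have same: "d (adj_swap z ` B) = M" if "z \<in> {1..<N - 1}" for z
    using that nonneg sum_nonneg_eq_0_iff[of "{1..<N - 1}" "\<lambda>z. M - d (adj_swap z ` B)"] by simp
  have "B \<noteq> {}" using Bs(2) k by auto
  then have min: "Min B \<in> B" "\<And>b. b \<in> B \<Longrightarrow> Min B \<le> b" using fin by auto
  then have "Min B \<in> sites N" "Min B \<noteq> 1" using Bs no1 by auto
  then have range: "Min B - 1 \<in> {1..<N - 1}" and suc: "Suc (Min B - 1) = Min B"
    by (auto simp: sites_def)
  have notin: "Min B - 1 \<notin> B" using min(2)[of "Min B - 1"] suc by auto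
  have "adj_swap (Min B - 1) ` B = insert (Min B - 1) (B - {Min B})"
    using swap_right[OF notin] min(1) suc by simp
  then have "\<Sum>(adj_swap (Min B - 1) ` B) = (Min B - 1) + \<Sum>(B - {Min B})"
    using fin notin by simp
  also have "\<dots> < \<Sum>B" using sum.remove[OF fin min(1), of "\<lambda>b. b"] suc by simp
  finally show False using least[OF swap_S[OF range] same[OF range]] by simp
qed

section \<open>An explicit solution of the balance equation\<close>

definition num_below :: "nat set \<Rightarrow> nat \<Rightarrow> nat" where
  "num_below A a = card {b \<in> A. b < a}"

definition shifted_weight :: "nat set \<Rightarrow> real" where
  "shifted_weight A = (\<Prod>a\<in>A. real a - real (num_below A a))"

text \<open>For \<open>\<rho>L = 0\<close> and \<open>\<rho>R = 1\<close> this is the stationary probability that all sites of \<open>A\<close> are occupied.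
  The shift \<open>l - 1\<close> of the \<open>l\<close>-th smallest element is written as the number of smaller elements,
  so that no enumeration of \<open>A\<close> is required.\<close>
definition unit_corr :: "nat \<Rightarrow> nat set \<Rightarrow> real" where
  "unit_corr N A = shifted_weight A / (\<Prod>k<card A. real N - real k)"

lemma num_below_swap:
  assumes "b \<noteq> Suc z"
  shows "num_below (adj_swap z ` A) b = num_below A b"
proof -
  have "{c \<in> adj_swap z ` A. c < b} = adj_swap z ` {c \<in> A. c < b}"
    using assms by (auto simp: Transposition.transpose_def image_iff split: if_splits)
  then show ?thesis by (simp add: num_below_def card_image)
qed

lemma num_below_Suc: "finite A \<Longrightarrow> num_below A (Suc z) = num_below A z + of_bool (z \<in> A)"
proof -
  assume "finite A"
  have "{b \<in> A. b < Suc z} = (if z \<in> A then insert z else id) {b \<in> A. b < z}"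
    by (auto simp: less_Suc_eq)
  then show ?thesis using \<open>finite A\<close> by (auto simp: num_below_def)
qed

text \<open>The numerator of \<open>unit_corr\<close> with the factor of \<open>z\<close> deleted but all other shifts kept. The value zero
  for \<open>z\<close> outside the set lets the swap formula below hold without a case distinction.\<close>
definition weight_without :: "nat set \<Rightarrow> nat \<Rightarrow> real" where
  "weight_without A z = of_bool (z \<in> A) * (\<Prod>b\<in>A - {z}. real b - real (num_below A b))"

lemma shifted_weight_remove:
  assumes "finite A" "z \<in> A"
  shows "shifted_weight A = (real z - real (num_below A z)) * weight_without A z"
  using prod.remove[OF assms] assms(2) by (simp add: shifted_weight_def weight_without_def)

text \<open>A particle moving from \<open>z\<close> to a free site \<open>Suc z\<close> raises its own factor by one and leaves the
  shifts of all others unchanged; the reverse move lowers it. If both sites are in \<open>A\<close>, the swap does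
  nothing, and the two terms on the right cancel because the factors of \<open>z\<close> and \<open>Suc z\<close> coincide:
  the site and its shift both increase by one.\<close>
lemma shifted_weight_swap_diff:
  assumes fin: "finite A"
  shows "shifted_weight (adj_swap z ` A) - shifted_weight A
       = weight_without A z - weight_without A (Suc z)"
proof -
  let ?y = "\<lambda>B b. real b - real (num_below B b)"
  consider "z \<in> A" "Suc z \<in> A" | "z \<in> A" "Suc z \<notin> A" | "z \<notin> A" "Suc z \<in> A"
    | "z \<notin> A" "Suc z \<notin> A" by blast
  then show ?thesis
  proof cases
    case 1
    have "(\<Prod>b\<in>A - {z}. ?y A b) = ?y A (Suc z) * (\<Prod>b\<in>A - {z} - {Suc z}. ?y A b)"
      using fin 1 by (intro prod.remove) auto
    also have "\<dots> = ?y A z * (\<Prod>b\<in>A - {Suc z} - {z}. ?y A b)"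
      using 1 by (simp add: num_below_Suc[OF fin] Diff_insert2[symmetric] insert_commute)
    also have "\<dots> = (\<Prod>b\<in>A - {Suc z}. ?y A b)"
      using fin 1 by (intro prod.remove[symmetric]) auto
    finally show ?thesis using 1 by (simp add: weight_without_def swap_both)
  next
    case 2
    let ?B = "adj_swap z ` A"
    have B: "?B = insert (Suc z) (A - {z})" using 2 by (rule swap_left)
    have "num_below ?B (Suc z) = num_below ?B z + of_bool (z \<in> ?B)" using fin by (intro num_below_Suc) simp
    moreover have "z \<notin> ?B" using B by auto
    ultimately have r: "num_below ?B (Suc z) = num_below A z" by (simp add: num_below_swap)
    have "shifted_weight ?B = ?y ?B (Suc z) * (\<Prod>b\<in>A - {z}. ?y ?B b)"
      unfolding shifted_weight_def by (subst (1) B) (use fin 2 in simp)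
    also have "(\<Prod>b\<in>A - {z}. ?y ?B b) = (\<Prod>b\<in>A - {z}. ?y A b)"
      by (rule prod.cong[OF refl], subst num_below_swap) (use 2 in auto)
    also have "\<dots> = weight_without A z"
      using 2 by (simp add: weight_without_def)
    finally show ?thesis
      using shifted_weight_remove[OF fin 2(1)] 2 r
      by (simp add: algebra_simps) (simp add: weight_without_def)
  next
    case 3
    let ?B = "adj_swap z ` A"
    have B: "?B = insert z (A - {Suc z})" using 3 by (rule swap_right)
    have "shifted_weight ?B = ?y ?B z * (\<Prod>b\<in>A - {Suc z}. ?y ?B b)"
      unfolding shifted_weight_def by (subst (1) B) (use fin 3 in simp)
    also have "(\<Prod>b\<in>A - {Suc z}. ?y ?B b) = weight_without A (Suc z)"
      using 3 by (auto simp: weight_without_def num_below_swap intro!: prod.cong)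
    finally show ?thesis
      using shifted_weight_remove[OF fin 3(2)] 3
      by (simp add: algebra_simps num_below_swap num_below_Suc[OF fin]) (simp add: weight_without_def)
  next
    case 4
    then show ?thesis by (simp add: weight_without_def swap_neither)
  qed
qed

lemma card_subset_sites: "A \<subseteq> sites N \<Longrightarrow> card A \<le> N - 1"
  using card_mono[OF finite_sites, of A N] by (simp add: sites_def)

text \<open>After telescoping, the left-hand side is the difference of the terms at sites 1 and \<open>N - 1\<close>. If
  \<open>1 \<in> A\<close>, the factor of site 1 is one, so deleting it changes nothing. If \<open>N - 1 \<in> A\<close>, that site is
  the largest element, its factor is \<open>N - card A\<close>, and removing it also removes the factor
  \<open>N - card A + 1\<close> from the denominator; the difference of these two is one.\<close>
lemma unit_corr_balance:
  assumes N: "N \<ge> 2" and A: "A \<subseteq> sites N"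
  shows "(\<Sum>z\<in>{1..<N - 1}. unit_corr N (adj_swap z ` A) - unit_corr N A)
       = of_bool (1 \<in> A) * unit_corr N A + of_bool (N - 1 \<in> A) * (unit_corr N A - unit_corr N (A - {N - 1}))"
proof -
  have fin: "finite A" using A finite_sites finite_subset by blast
  let ?D = "\<lambda>n. \<Prod>k<n. real N - real k" and ?q = "weight_without A"
  have D0: "?D n \<noteq> 0" if "n \<le> N - 1" for n using that N by auto
  have left: "?q 1 / ?D (card A) = of_bool (1 \<in> A) * unit_corr N A"
  proof (cases "1 \<in> A")
    case True
    have "{b \<in> A. b < 1} = {}" using A by (auto simp: sites_def)
    then have "num_below A 1 = 0" unfolding num_below_def by (simp only: card.empty)
    then show ?thesis using shifted_weight_remove[OF fin True] True by (simp add: unit_corr_def)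
  qed (simp add: weight_without_def)
  have right: "?q (N - 1) / ?D (card A)
      = of_bool (N - 1 \<in> A) * (unit_corr N (A - {N - 1}) - unit_corr N A)"
  proof (cases "N - 1 \<in> A")
    case True
    let ?n = "card A - 1"
    have n: "card A = Suc ?n" using True fin by (metis Suc_pred' card_gt_0_iff empty_iff diff_Suc_1)
    have "{b \<in> A. b < N - 1} = A - {N - 1}" using A by (fastforce simp: sites_def)
    then have num_below: "num_below A (N - 1) = ?n" using True fin by (simp add: num_below_def)
    have W: "shifted_weight A = (real N - 1 - real ?n) * ?q (N - 1)"
      using shifted_weight_remove[OF fin True] num_below N by (simp add: of_nat_diff)
    have ranks: "num_below (A - {N - 1}) b = num_below A b" if "b \<in> A - {N - 1}" for b
    proof -
      have "b < N - 1" using that A by (fastforce simp: sites_def)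
      then have "{c \<in> A - {N - 1}. c < b} = {c \<in> A. c < b}" by auto
      then show ?thesis by (simp add: num_below_def)
    qed
    have W': "shifted_weight (A - {N - 1}) = ?q (N - 1)"
      using True ranks by (simp add: shifted_weight_def weight_without_def)
    have ne: "real N - real ?n \<noteq> 0" "?D ?n \<noteq> 0"
      using card_subset_sites[OF A] n N D0[of ?n] by auto
    have D: "?D (card A) = ?D ?n * (real N - real ?n)" by (subst n) simp
    have c': "unit_corr N (A - {N - 1}) = ?q (N - 1) / ?D ?n"
      using True fin W' by (simp add: unit_corr_def)
    have "?q (N - 1) / (?D ?n * (real N - real ?n)) = ?q (N - 1) / ?D ?n
        - (real N - 1 - real ?n) * ?q (N - 1) / (?D ?n * (real N - real ?n))"
      using ne by (simp add: field_simps)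
    then show ?thesis using True unfolding unit_corr_def[of N A] c' W D by simp
  qed (simp add: weight_without_def)
  have "(\<Sum>z\<in>{1..<N - 1}. unit_corr N (adj_swap z ` A) - unit_corr N A)
      = - (\<Sum>z\<in>{1..<N - 1}. ?q (Suc z) - ?q z) / ?D (card A)"
    by (simp add: unit_corr_def card_swap diff_divide_distrib[symmetric] shifted_weight_swap_diff[OF fin]
        sum_divide_distrib sum_negf[symmetric])
  also have "\<dots> = ?q 1 / ?D (card A) - ?q (N - 1) / ?D (card A)"
    using N by (subst sum_Suc_diff') (auto simp: diff_divide_distrib)
  finally show ?thesis unfolding left right by (simp only: right_diff_distrib)
qed

section \<open>Stationary moments of centered products\<close>

text \<open>Induction on the size of \<open>A\<close>. The two sides obey the same balance equation, and the inhomogeneous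
  term involves a set with one element fewer. Hence the maximum principle applies to the difference of the two
  sides and to its negative.\<close>
lemma expectation_centered_prod:
  assumes N: "N \<ge> 2"
    and stat: "stationary_distribution N (\<lambda>x y. of_bool (\<bar>int x - int y\<bar> = 1)) 1 1 \<rho>L \<rho>R \<mu>"
    and A: "A \<subseteq> sites N"
  shows "measure_pmf.expectation \<mu> (centered_prod \<rho>L A) = (\<rho>R - \<rho>L) ^ card A * unit_corr N A"
  using A
proof (induction "card A" arbitrary: A)
  case 0
  then have "A = {}" using finite_sites finite_subset by (metis card_0_eq)
  then show ?case by (simp add: centered_prod_def unit_corr_def shifted_weight_def)
next
  case (Suc k)
  let ?m = "\<lambda>B. measure_pmf.expectation \<mu> (centered_prod \<rho>L B)" and ?r = "\<rho>R - \<rho>L"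
  define d where "d B = ?m B - ?r ^ card B * unit_corr N B" for B
  have balance: "(\<Sum>z\<in>{1..<N - 1}. d (adj_swap z ` B) - d B)
      = of_bool (1 \<in> B) * d B + of_bool (N - 1 \<in> B) * d B"
    if B: "B \<subseteq> sites N" "card B = Suc k" for B
  proof -
    have fin: "finite B" using B finite_sites finite_subset by blast
    have "(\<Sum>z\<in>{1..<N - 1}. d (adj_swap z ` B) - d B)
      = (\<Sum>z\<in>{1..<N - 1}. ?m (adj_swap z ` B) - ?m B)
        - ?r ^ Suc k * (\<Sum>z\<in>{1..<N - 1}. unit_corr N (adj_swap z ` B) - unit_corr N B)"
      by (simp add: d_def card_swap B sum_subtractf sum_distrib_left right_diff_distrib
          del: power_Suc)
    also have "\<dots> = of_bool (1 \<in> B) * d B + of_bool (N - 1 \<in> B) * (d B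
        - (?r * ?m (B - {N - 1}) - ?r ^ Suc k * unit_corr N (B - {N - 1})))"
      unfolding expectation_centered_prod_balance[OF N stat B(1)] unit_corr_balance[OF N B(1)]
      using B by (simp add: d_def algebra_simps del: power_Suc)
    also have "of_bool (N - 1 \<in> B) * (d B
          - (?r * ?m (B - {N - 1}) - ?r ^ Suc k * unit_corr N (B - {N - 1})))
        = of_bool (N - 1 \<in> B) * d B"
    proof (cases "N - 1 \<in> B")
      case True
      then have "k = card (B - {N - 1})" using B fin by simp
      with Suc.hyps(1)[of "B - {N - 1}"] B(1) have "?m (B - {N - 1}) = ?r ^ k * unit_corr N (B - {N - 1})"
        by auto
      then show ?thesis by simp
    qed simp
    finally show ?thesis .
  qed
  have "d A \<le> 0"
    by (rule balance_max_principle[of "Suc k" N d]) (use balance Suc in auto)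
  moreover have "- d A \<le> 0"
  proof (rule balance_max_principle[of "Suc k" N "\<lambda>B. - d B"])
    fix B assume "B \<subseteq> sites N" "card B = Suc k"
    from balance[OF this]
    show "(\<Sum>z\<in>{1..<N - 1}. - d (adj_swap z ` B) - - d B)
        = of_bool (1 \<in> B) * - d B + of_bool (N - 1 \<in> B) * - d B"
      by (simp add: sum_subtractf)
  qed (use Suc in auto)
  ultimately show ?case by (simp add: d_def)
qed

section \<open>Increasing index tuples as subsets\<close>

text \<open>A tuple is the increasing enumeration of its range, hence determined by it.\<close>
lemma index_tuples_bij:
  "bij_betw (\<lambda>i. i ` {1..j}) (index_tuples j n) {I. I \<subseteq> {1..n} \<and> card I = j}"
proof (rule bij_betwI')
  fix i i' assume i: "i \<in> index_tuples j n" and i': "i' \<in> index_tuples j n"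
  have "i = i'" if eq: "i ` {1..j} = i' ` {1..j}"
  proof (rule PiE_ext)
    show "i \<in> {1..j} \<rightarrow>\<^sub>E {1..n}" "i' \<in> {1..j} \<rightarrow>\<^sub>E {1..n}"
      using i i' by (auto simp: index_tuples_def)
    have m: "strict_mono_on {1..j} i" "strict_mono_on {1..j} i'"
      using i i' by (auto simp: index_tuples_def)
    fix l assume "l \<in> {1..j}"
    then show "i l = i' l"
    proof (induction l rule: less_induct)
      case (less l)
      obtain p where p: "p \<in> {1..j}" "i l = i' p" using eq less.prems by (metis imageE imageI)
      obtain q where q: "q \<in> {1..j}" "i' l = i q" using eq less.prems by (metis imageE imageI)
      \<comment> \<open>If \<open>p < l\<close>, the tuples agree at \<open>p\<close>, so \<open>i\<close> takes the same value at \<open>p\<close> and \<open>l\<close>; likewise for \<open>q\<close>.\<close>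
      have "\<not> p < l"
      proof
        assume "p < l"
        then have "i p = i l" using less.IH[OF _ p(1)] p(2) by simp
        then show False using strict_mono_onD[OF m(1) p(1) less.prems \<open>p < l\<close>] by simp
      qed
      moreover have "\<not> q < l"
      proof
        assume "q < l"
        then have "i' q = i' l" using less.IH[OF _ q(1)] q(2) by simp
        then show False using strict_mono_onD[OF m(2) q(1) less.prems \<open>q < l\<close>] by simp
      qed
      moreover have "i' l \<le> i' p" if "l \<le> p"
        using that strict_mono_onD[OF m(2) less.prems p(1)] by (cases "l = p") auto
      moreover have "i l \<le> i q" if "l \<le> q"
        using that strict_mono_onD[OF m(1) less.prems q(1)] by (cases "l = q") auto
      ultimately show ?case using p(2) q(2) by simp
    qed
  qed
  then show "(i ` {1..j} = i' ` {1..j}) = (i = i')" by auto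
next
  fix i assume i: "i \<in> index_tuples j n"
  then have "inj_on i {1..j}" by (auto simp: index_tuples_def intro: strict_mono_on_imp_inj_on)
  then show "i ` {1..j} \<in> {I. I \<subseteq> {1..n} \<and> card I = j}"
    using i by (auto simp: index_tuples_def card_image)
next
  fix I assume "I \<in> {I. I \<subseteq> {1..n} \<and> card I = j}"
  then have I: "I \<subseteq> {1..n}" "card I = j" "finite I" using finite_subset by auto
  from ex_bij_betw_strict_mono_card[OF I(3)] obtain h
    where h: "bij_betw h {..<j} I" "strict_mono_on {..<j} h" unfolding I(2) by metis
  \<comment> \<open>The increasing enumeration \<open>h\<close> is indexed from zero, index tuples from one.\<close>
  define i where "i = (\<lambda>l\<in>{1..j}. h (l - 1))"
  have "(\<lambda>l. l - 1) ` {1..j} = {..<j}"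
    by (auto simp: image_iff intro!: bexI[of _ "Suc _"])
  then have img: "i ` {1..j} = I"
    using h(1) unfolding i_def image_restrict_eq by (metis bij_betw_imp_surj_on image_image)
  have "strict_mono_on {1..j} i"
    unfolding i_def by (auto simp: strict_mono_on_def intro!: h(2)[unfolded strict_mono_on_def, rule_format])
  moreover have "i \<in> {1..j} \<rightarrow>\<^sub>E {1..n}"
    using img I(1) unfolding i_def by (auto simp: PiE_iff)
  ultimately show "\<exists>i\<in>index_tuples j n. I = i ` {1..j}"
    using img by (auto simp: index_tuples_def)
qed

lemma sum_index_tuples:
  "(\<Sum>j = 0..n. \<Sum>i\<in>index_tuples j n. F j (i ` {1..j})) = (\<Sum>I\<in>Pow {1..n}. F (card I) I)"
proof -
  have "(\<Sum>j = 0..n. \<Sum>i\<in>index_tuples j n. F j (i ` {1..j}))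
      = (\<Sum>j = 0..n. \<Sum>I\<in>{I \<in> Pow {1..n}. card I = j}. F (card I) I)"
    by (intro sum.cong refl, subst sum.reindex_bij_betw[OF index_tuples_bij]) (auto intro!: sum.cong)
  also have "\<dots> = (\<Sum>I\<in>Pow {1..n}. F (card I) I)"
    by (rule sum.group) (auto dest: card_mono[rotated])
  finally show ?thesis .
qed

lemma shifted_prod_eq_unit_corr:
  assumes x: "strict_mono_on {1..n} x" and i: "i \<in> index_tuples j n"
  shows "shifted_prod N x j i = unit_corr N (x ` i ` {1..j})"
proof -
  define y where "y l = x (i l)" for l
  have img: "x ` i ` {1..j} = y ` {1..j}" by (simp add: y_def image_image)
  have i': "\<And>l. l \<in> {1..j} \<Longrightarrow> i l \<in> {1..n}" "strict_mono_on {1..j} i"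
    using i by (auto simp: index_tuples_def)
  have y: "strict_mono_on {1..j} y"
    unfolding y_def
    using i'(1) strict_mono_onD[OF i'(2)] by (intro strict_mono_onI strict_mono_onD[OF x]) blast+
  then have inj: "inj_on y {1..j}" by (rule strict_mono_on_imp_inj_on)
  have below: "num_below (y ` {1..j}) (y l) = l - 1" if l: "l \<in> {1..j}" for l
  proof -
    have "y k < y l \<longleftrightarrow> k < l" if "k \<in> {1..j}" for k
      using strict_mono_onD[OF y that l] strict_mono_onD[OF y l that]
      by (metis linorder_neqE_nat order_less_asym)
    then have "{b \<in> y ` {1..j}. b < y l} = y ` {k \<in> {1..j}. k < l}" by auto
    also have "{k \<in> {1..j}. k < l} = {1..l - 1}" using l by auto
    finally have "{b \<in> y ` {1..j}. b < y l} = y ` {1..l - 1}" .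
    moreover have "inj_on y {1..l - 1}" by (rule inj_on_subset[OF inj]) (use l in auto)
    ultimately show ?thesis by (simp add: num_below_def card_image)
  qed
  have "shifted_weight (y ` {1..j}) = (\<Prod>l\<in>{1..j}. real (y l) - (real l - 1))"
    unfolding shifted_weight_def prod.reindex[OF inj]
  proof (rule prod.cong[OF refl])
    fix l assume l: "l \<in> {1..j}"
    then have "real (l - 1) = real l - 1" by (simp add: of_nat_diff)
    then show "((\<lambda>a. real a - real (num_below (y ` {1..j}) a)) \<circ> y) l = real (y l) - (real l - 1)"
      by (simp only: o_apply below[OF l])
  qed
  moreover have "(\<Prod>k<card (y ` {1..j}). real N - real k) = (\<Prod>l = 1..j. real N - (real l - 1))"
    unfolding card_image[OF inj] by (simp add: lessThan_atLeast0 prod.atLeast1_atMost_eq)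
  ultimately show ?thesis
    unfolding img unit_corr_def shifted_prod_def y_def[symmetric] by (simp only: prod_dividef)
qed

lemma sum_shifted_prod:
  assumes "strict_mono_on {1..n} x"
  shows "(\<Sum>j = 0..n. \<Sum>i\<in>index_tuples j n. F j (i ` {1..j}) * shifted_prod N x j i)
       = (\<Sum>I\<in>Pow {1..n}. F (card I) I * unit_corr N (x ` I))"
  unfolding sum_index_tuples[symmetric, where F = "\<lambda>j I. F j I * unit_corr N (x ` I)"]
  using shifted_prod_eq_unit_corr[OF assms] by (intro sum.cong refl) simp

section \<open>Truncated and full correlations\<close>

theorem proposition1p6:
  fixes N :: nat and \<rho>L \<rho>R :: real and \<mu> :: "config pmf"
    and n :: nat and x :: "nat \<Rightarrow> nat"
  assumes "N \<ge> 2"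
    and "0 < \<rho>L" "\<rho>L < 1" "0 < \<rho>R" "\<rho>R < 1"
    and "stationary_distribution N (\<lambda>x y. of_bool (\<bar>int x - int y\<bar> = 1)) 1 1 \<rho>L \<rho>R \<mu>"
    and "strict_mono_on {1..n} x" "\<forall>i\<in>{1..n}. 1 \<le> x i \<and> x i \<le> N - 1"
  shows "measure_pmf.expectation \<mu> (\<lambda>\<eta>. \<Prod>i = 1..n.
           (real (\<eta> (x i)) - measure_pmf.expectation \<mu> (\<lambda>\<zeta>. real (\<zeta> (x i)))))
           = (\<rho>R - \<rho>L) ^ n * psi N n x
       \<and> measure_pmf.expectation \<mu> (\<lambda>\<eta>. \<Prod>i = 1..n. real (\<eta> (x i)))
           = (\<Sum>j = 0..n. \<rho>L ^ (n - j) * (\<rho>R - \<rho>L) ^ j *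
               (\<Sum>i\<in>index_tuples j n. shifted_prod N x j i))"
proof -
  let ?E = "measure_pmf.expectation \<mu>" and ?r = "\<rho>R - \<rho>L"
  note N = assms(1) and stat = assms(6) and mono = assms(7)
  have supp: "set_pmf \<mu> \<subseteq> configs N"
    using stat by (simp add: stationary_distribution_def)
  have int [simp]: "integrable (measure_pmf \<mu>) f" for f :: "config \<Rightarrow> real"
    using finite_subset[OF supp finite_configs] by (rule integrable_measure_pmf_finite)
  have inj: "inj_on x {1..n}" using mono by (rule strict_mono_on_imp_inj_on)
  have sites: "x i \<in> sites N" if "i \<in> {1..n}" for i
    using assms(8) that by (simp add: sites_def)
  have centered: "?E (\<lambda>\<eta>. \<Prod>i\<in>I. real (\<eta> (x i)) - \<rho>L) = ?r ^ card I * unit_corr N (x ` I)"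
    if I: "I \<subseteq> {1..n}" for I
  proof -
    have "inj_on x I" using inj I by (rule inj_on_subset)
    moreover have "x ` I \<subseteq> sites N" using sites I by auto
    ultimately show ?thesis
      using expectation_centered_prod[OF N stat, of "x ` I"]
      by (simp add: centered_prod_def[abs_def] prod.reindex card_image)
  qed
  have expand: "?E (\<lambda>\<eta>. \<Prod>i = 1..n. (real (\<eta> (x i)) - \<rho>L) + c i)
      = (\<Sum>I\<in>Pow {1..n}. (?r ^ card I * (\<Prod>i\<in>{1..n} - I. c i)) * unit_corr N (x ` I))" for c
  proof -
    have "?E (\<lambda>\<eta>. \<Prod>i = 1..n. (real (\<eta> (x i)) - \<rho>L) + c i)
      = (\<Sum>I\<in>Pow {1..n}. ?E (\<lambda>\<eta>. \<Prod>i\<in>I. real (\<eta> (x i)) - \<rho>L) * (\<Prod>i\<in>{1..n} - I. c i))"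
      by (subst prod_add) simp_all
    also have "\<dots> = (\<Sum>I\<in>Pow {1..n}. (?r ^ card I * (\<Prod>i\<in>{1..n} - I. c i)) * unit_corr N (x ` I))"
      by (intro sum.cong refl) (auto simp: centered)
    finally show ?thesis .
  qed
  have mean: "?E (\<lambda>\<zeta>. real (\<zeta> (x i))) = \<rho>L + ?r * (real (x i) / real N)"
    if i: "i \<in> {1..n}" for i
  proof -
    have "{b \<in> {x i}. b < x i} = {}" by auto
    then have "num_below {x i} (x i) = 0" unfolding num_below_def by (simp only: card.empty)
    then have "unit_corr N {x i} = real (x i) / real N"
      by (simp add: unit_corr_def shifted_weight_def)
    then show ?thesis using centered[of "{i}"] i by (simp add: algebra_simps)
  qed
  have card_compl: "card ({1..n} - I) = n - card I" "card I \<le> n" if "I \<subseteq> {1..n}" for I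
    using that card_Diff_subset[OF finite_subset[OF that], of "{1..n}"] card_mono[OF _ that] by auto
  have "?E (\<lambda>\<eta>. \<Prod>i = 1..n. (real (\<eta> (x i)) - ?E (\<lambda>\<zeta>. real (\<zeta> (x i)))))
      = ?E (\<lambda>\<eta>. \<Prod>i = 1..n. (real (\<eta> (x i)) - \<rho>L) + (- ?r) * (real (x i) / real N))"
  proof (intro arg_cong[of _ _ ?E] ext prod.cong refl)
    have "a - (\<rho>L + ?r * q) = (a - \<rho>L) + (- ?r) * q" for a q by (simp add: algebra_simps)
    then show "real (\<eta> (x i)) - ?E (\<lambda>\<zeta>. real (\<zeta> (x i)))
        = (real (\<eta> (x i)) - \<rho>L) + (- ?r) * (real (x i) / real N)" if "i \<in> {1..n}" for \<eta> i
      by (simp only: mean[OF that])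
  qed
  also have "\<dots> = (\<Sum>I\<in>Pow {1..n}. (?r ^ n * ((-1) ^ (n - card I)
      * (\<Prod>i\<in>{1..n} - I. real (x i) / real N))) * unit_corr N (x ` I))"
    unfolding expand
  proof (rule sum.cong[OF refl], rule arg_cong2[where f = "(*)", OF _ refl])
    fix I assume "I \<in> Pow {1..n}"
    then have I: "I \<subseteq> {1..n}" by simp
    have "(\<Prod>i\<in>{1..n} - I. (- ?r) * (real (x i) / real N))
        = (- ?r) ^ (n - card I) * (\<Prod>i\<in>{1..n} - I. real (x i) / real N)"
      by (simp only: prod.distrib prod_constant card_compl[OF I])
    moreover have "?r ^ card I * (- ?r) ^ (n - card I) = ?r ^ n * (-1) ^ (n - card I)"
      using card_compl(2)[OF I] power_add[of ?r "card I" "n - card I"]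
      by (subst power_minus) simp
    ultimately show "?r ^ card I * (\<Prod>i\<in>{1..n} - I. (- ?r) * (real (x i) / real N))
        = ?r ^ n * ((-1) ^ (n - card I) * (\<Prod>i\<in>{1..n} - I. real (x i) / real N))"
      by (simp add: mult.assoc[symmetric])
  qed
  also have "\<dots> = ?r ^ n * psi N n x"
    unfolding sum_shifted_prod[OF mono, symmetric,
        where F = "\<lambda>j I. ?r ^ n * ((-1) ^ (n - j) * (\<Prod>i\<in>{1..n} - I. real (x i) / real N))"]
    by (simp add: psi_def sum_distrib_left mult_ac)
  finally have centered_moment: "?E (\<lambda>\<eta>. \<Prod>i = 1..n. (real (\<eta> (x i)) - ?E (\<lambda>\<zeta>. real (\<zeta> (x i)))))
      = ?r ^ n * psi N n x" .
  have "?E (\<lambda>\<eta>. \<Prod>i = 1..n. real (\<eta> (x i)))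
      = ?E (\<lambda>\<eta>. \<Prod>i = 1..n. (real (\<eta> (x i)) - \<rho>L) + \<rho>L)"
    by simp
  also have "\<dots> = (\<Sum>I\<in>Pow {1..n}. (\<rho>L ^ (n - card I) * ?r ^ card I) * unit_corr N (x ` I))"
    unfolding expand
    by (intro sum.cong refl) (simp only: Pow_iff prod_constant card_compl mult_ac)
  also have "\<dots> = (\<Sum>j = 0..n. \<rho>L ^ (n - j) * ?r ^ j *
      (\<Sum>i\<in>index_tuples j n. shifted_prod N x j i))"
    unfolding sum_shifted_prod[OF mono, symmetric, where F = "\<lambda>j I. \<rho>L ^ (n - j) * ?r ^ j"]
    by (simp add: sum_distrib_left)
  finally show ?thesis using centered_moment by blast
qed

end
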